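(* Let $m\ge3$ be an integer, $0<\rho\le\frac13$, $\mathcal I=[0,1]$ and $\mathcal I_\rho=[-\rho,1+\rho]$. Let $\Pi_0\colon C^1\Lambda^0(\mathcal I_\rho)\to\mathbb P_m\Lambda^0(\mathcal I)$ and $\Pi_1\colon C^0\Lambda^1(\mathcal I_\rho)\to\mathbb P_{m-1}\Lambda^1(\mathcal I)$ be the higher-order quasi-interpolation operators defined in the context. Then they commute with the exterior derivative: $d^0\Pi_0u=\Pi_1d^0u$ for all $u\in C^1\Lambda^0(\mathcal I_\rho)$.
   Context: On an interval, $0$-forms are functions, $1$-forms $v\,dx$ are identified with their coefficient $v$, and $d^0u=u'$. $\mathbb P_m\Lambda^0(\mathcal I)=\mathbb P_m(\mathcal I)$, $\mathbb P_{m-1}\Lambda^1(\mathcal I)=\mathbb P_{m-1}(\mathcal I)$ (polynomials of degree at most $m$, resp. $m-1$). Let $\eta(x)=C\exp\bigl(\frac1{|x|^2-1}\bigr)$ for $|x|<1$, $\eta(x)=0$ for $|x|\ge1$, with $\int_{\mathbb R}\eta=1$; $\eta_l(x)=\frac1\rho\eta(\frac x\rho)$, $\eta_r(x)=\frac1\rho\eta(\frac{x-1}\rho)$; $B_l,B_r$ the intervals of radius $\rho$ centered at $0$ and $1$. For $y_l\in B_l$, $y_r\in B_r$ let $\tilde\ell_i$ be the orthogonal (Legendre) polynomial of degree $i$ on $[y_l,y_r]$, normalized by $\tilde\ell_i(y_r)=1$. Set, for $u\in C^1(\mathcal I_\rho)$, $\widetilde{\mathcal N^0_1}(u)=u'(y_l)$,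 $\widetilde{\mathcal N^0_2}(u)=u'(y_r)$, $\widetilde{\mathcal N^0_{i+3}}(u)=\int_{y_l}^{y_r}\tilde\ell_iu'\,dx$ for $i=0,\dots,m-3$, $\widetilde{\mathcal N^0_{m+1}}(u)=u(y_r)+u(y_l)$; and for $v\in C^0(\mathcal I_\rho)$, $\widetilde{\mathcal N^1_1}(v)=v(y_l)$, $\widetilde{\mathcal N^1_2}(v)=v(y_r)$, $\widetilde{\mathcal N^1_{i+3}}(v)=\int_{y_l}^{y_r}\tilde\ell_iv\,dx$ for $i=0,\dots,m-3$. Weighted node functionals: $\overline{\mathcal N^k_i}(u)=\int_{B_l}\int_{B_r}\eta_l(\xi_l)\eta_r(\xi_r)\widetilde{\mathcal N^k_i}(u)\,d\xi_r\,d\xi_l$ with $y_l=\xi_l$, $y_r=\xi_r$. Let $\ell_i$ be the Legendre polynomial of degree $i$ on $[0,1]$ with $\ell_i(1)=1$, $L_i(x)=\int_0^x\ell_i(t)\,dt$, $K_i(x)=\int_0^xL_i(t)\,dt$. Basis functions: $\varphi^0_1=x-2x^2+x^3$, $\varphi^0_2=-x^2+x^3$, $\varphi^0_3=-\frac12+3x^2-2x^3$, $\varphi^0_{m+1}=\frac12$, $\varphi^0_i=K_{i-2}$ for $4\le i\le m$; $\varphi^1_1=1-4x+3x^2$, $\varphi^1_2=-2x+3x^2$, $\varphi^1_3=6x-6x^2$, $\varphi^1_i=L_{i-2}$ for $4\le i\le m$. Quasi-interpolation operators: $\Pi_0u=\sum_{i=1}^{m+1}\overline{\mathcal N^0_i}(u)\varphi^0_i$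 and $\Pi_1v=\sum_{i=1}^m\overline{\mathcal N^1_i}(v)\varphi^1_i$. *)

theory Defs
  imports "HOL-Analysis.Analysis" "HOL-Computational_Algebra.Polynomial"
begin

section \<open>Forms on an interval\<close>

text \<open>
  Forms on \<open>S\<close> are represented by functions \<^typ>\<open>real \<Rightarrow> real\<close> of which only the values
  on \<open>S\<close> matter, a 1-form being identified with its coefficient. On a closed
  interval, derivatives at the end points are one-sided.
\<close>

definition d0 :: "real set \<Rightarrow> (real \<Rightarrow> real) \<Rightarrow> real \<Rightarrow> real" where
  "d0 S u x = vector_derivative u (at x within S)"

definition C0_forms1 :: "real set \<Rightarrow> (real \<Rightarrow> real) set" where
  "C0_forms1 S = {v. continuous_on S v}"

definition C1_forms0 :: "real set \<Rightarrow> (real \<Rightarrow> real) set" where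
  "C1_forms0 S = {u. \<exists>u'. (\<forall>x\<in>S. (u has_real_derivative u' x) (at x within S)) \<and> continuous_on S u'}"

definition poly_forms :: "nat \<Rightarrow> real set \<Rightarrow> (real \<Rightarrow> real) set" where
  "poly_forms k S = {f. \<exists>p. degree p \<le> k \<and> (\<forall>x\<in>S. f x = poly p x)}"

definition I_unit :: "real set" where
  "I_unit = {0..1}"

definition I_ext :: "real \<Rightarrow> real set" where
  "I_ext \<rho> = {-\<rho>..1 + \<rho>}"


section \<open>Mollifiers\<close>

definition bump :: "real \<Rightarrow> real" where
  "bump x = (if \<bar>x\<bar> < 1 then exp (1 / (\<bar>x\<bar>\<^sup>2 - 1)) else 0)"

text \<open>The factor \<open>1 / integral UNIV bump\<close> is the constant \<open>C\<close>, see \<open>integral_eta\<close> below.\<close>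

definition eta :: "real \<Rightarrow> real" where
  "eta x = (1 / integral UNIV bump) * bump x"

definition eta_l :: "real \<Rightarrow> real \<Rightarrow> real" where
  "eta_l \<rho> x = (1 / \<rho>) * eta (x / \<rho>)"

definition eta_r :: "real \<Rightarrow> real \<Rightarrow> real" where
  "eta_r \<rho> x = (1 / \<rho>) * eta ((x - 1) / \<rho>)"

definition B_l :: "real \<Rightarrow> real set" where
  "B_l \<rho> = cball 0 \<rho>"

definition B_r :: "real \<Rightarrow> real set" where
  "B_r \<rho> = cball 1 \<rho>"


section \<open>Legendre polynomials on an interval\<close>

text \<open>For \<open>a < b\<close> the description is definite, see \<open>legendre_ex1\<close> below.\<close>

definition is_legendre :: "real \<Rightarrow> real \<Rightarrow> nat \<Rightarrow> real poly \<Rightarrow> bool" where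
  "is_legendre a b n p \<longleftrightarrow>
     degree p = n \<and>
     (\<forall>q. degree q < n \<longrightarrow> integral {a..b} (\<lambda>x. poly p x * poly q x) = 0) \<and>
     poly p b = 1"

definition legendre :: "real \<Rightarrow> real \<Rightarrow> nat \<Rightarrow> real poly" where
  "legendre a b n = (THE p. is_legendre a b n p)"


section \<open>Node functionals\<close>

text \<open>The index \<open>i\<close> ranges over \<open>1..m+1\<close> in \<open>N0\<close> and over \<open>1..m\<close> in \<open>N1\<close>.\<close>

definition N0 :: "nat \<Rightarrow> real \<Rightarrow> real \<Rightarrow> real \<Rightarrow> nat \<Rightarrow> (real \<Rightarrow> real) \<Rightarrow> real" where
  "N0 m \<rho> y\<^sub>l y\<^sub>r i u =
     (if i = 1 then d0 (I_ext \<rho>) u y\<^sub>l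
      else if i = 2 then d0 (I_ext \<rho>) u y\<^sub>r
      else if i = m + 1 then u y\<^sub>r + u y\<^sub>l
      else integral {y\<^sub>l..y\<^sub>r} (\<lambda>x. poly (legendre y\<^sub>l y\<^sub>r (i - 3)) x * d0 (I_ext \<rho>) u x))"

definition N1 :: "real \<Rightarrow> real \<Rightarrow> nat \<Rightarrow> (real \<Rightarrow> real) \<Rightarrow> real" where
  "N1 y\<^sub>l y\<^sub>r i v =
     (if i = 1 then v y\<^sub>l
      else if i = 2 then v y\<^sub>r
      else integral {y\<^sub>l..y\<^sub>r} (\<lambda>x. poly (legendre y\<^sub>l y\<^sub>r (i - 3)) x * v x))"

definition N0_bar :: "nat \<Rightarrow> real \<Rightarrow> nat \<Rightarrow> (real \<Rightarrow> real) \<Rightarrow> real" where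
  "N0_bar m \<rho> i u =
     integral (B_l \<rho>) (\<lambda>\<xi>\<^sub>l. integral (B_r \<rho>) (\<lambda>\<xi>\<^sub>r.
       eta_l \<rho> \<xi>\<^sub>l * eta_r \<rho> \<xi>\<^sub>r * N0 m \<rho> \<xi>\<^sub>l \<xi>\<^sub>r i u))"

definition N1_bar :: "real \<Rightarrow> nat \<Rightarrow> (real \<Rightarrow> real) \<Rightarrow> real" where
  "N1_bar \<rho> i v =
     integral (B_l \<rho>) (\<lambda>\<xi>\<^sub>l. integral (B_r \<rho>) (\<lambda>\<xi>\<^sub>r.
       eta_l \<rho> \<xi>\<^sub>l * eta_r \<rho> \<xi>\<^sub>r * N1 \<xi>\<^sub>l \<xi>\<^sub>r i v))"


section \<open>Basis functions\<close>

text \<open>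
  \<^term>\<open>integral {0..x} f\<close> agrees with the oriented integral from \<open>0\<close> to \<open>x\<close> only for
  \<open>x \<ge> 0\<close>; all basis functions are used on the unit interval only.
\<close>

definition L_fun :: "nat \<Rightarrow> real \<Rightarrow> real" where
  "L_fun i x = integral {0..x} (\<lambda>t. poly (legendre 0 1 i) t)"

definition K_fun :: "nat \<Rightarrow> real \<Rightarrow> real" where
  "K_fun i x = integral {0..x} (\<lambda>t. L_fun i t)"

definition phi0 :: "nat \<Rightarrow> nat \<Rightarrow> real \<Rightarrow> real" where
  "phi0 m i x =
     (if i = 1 then x - 2 * x^2 + x^3
      else if i = 2 then - (x^2) + x^3
      else if i = 3 then - (1/2) + 3 * x^2 - 2 * x^3
      else if i = m + 1 then 1/2
      else K_fun (i - 2) x)"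

definition phi1 :: "nat \<Rightarrow> real \<Rightarrow> real" where
  "phi1 i x =
     (if i = 1 then 1 - 4 * x + 3 * x^2
      else if i = 2 then - 2 * x + 3 * x^2
      else if i = 3 then 6 * x - 6 * x^2
      else L_fun (i - 2) x)"


section \<open>Quasi-interpolation operators\<close>

definition Pi0 :: "nat \<Rightarrow> real \<Rightarrow> (real \<Rightarrow> real) \<Rightarrow> real \<Rightarrow> real" where
  "Pi0 m \<rho> u x = (\<Sum>i = 1..m + 1. N0_bar m \<rho> i u * phi0 m i x)"

definition Pi1 :: "nat \<Rightarrow> real \<Rightarrow> (real \<Rightarrow> real) \<Rightarrow> real \<Rightarrow> real" where
  "Pi1 m \<rho> v x = (\<Sum>i = 1..m. N1_bar \<rho> i v * phi1 i x)"


section \<open>The normalizing constant and the Legendre polynomials are well defined\<close>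

lemma bump_integral: "bump integrable_on UNIV" "0 < integral UNIV bump"
proof -
  have m: "bump \<in> borel_measurable borel"
    unfolding bump_def by measurable
  have b: "\<bar>bump x\<bar> \<le> indicator {-1..1} x" for x
  proof (cases "\<bar>x\<bar> < 1")
    case True
    then have "\<bar>x\<bar>\<^sup>2 - 1 < 0" by (simp add: abs_square_less_1)
    then show ?thesis using True by (auto simp: bump_def indicator_def divide_le_0_iff)
  qed (auto simp: bump_def)
  have I: "integrable lborel bump"
    by (rule Bochner_Integration.integrable_bound[where f = "indicator {-1..1} :: real \<Rightarrow> real"])
       (use m b in auto)
  have H: "(bump has_integral (LINT x|lborel. bump x)) UNIV"
    using I by (rule has_integral_integral_lborel)
  then show i: "bump integrable_on UNIV" by blast
  have nn: "0 \<le> bump x" for x by (simp add: bump_def)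
  have c: "((\<lambda>x. if x \<in> {-1/2..1/2} then exp (-(4/3)) else 0) has_integral exp (-(4/3 :: real))) (UNIV :: real set)"
    unfolding has_integral_restrict_UNIV
    using has_integral_const_real[of "exp (-(4/3::real))" "-1/2" "1/2"] by simp
  have "exp (-(4/3)) \<le> integral UNIV bump"
  proof (rule has_integral_le[OF c])
    show "(bump has_integral integral UNIV bump) UNIV"
      using i by (rule integrable_integral)
    fix x :: real
    show "(if x \<in> {-1/2..1/2} then exp (-(4/3)) else 0) \<le> bump x"
    proof (cases "x \<in> {-1/2..1/2}")
      case True
      then have a: "\<bar>x\<bar> \<le> 1/2" by auto
      then have "\<bar>x\<bar>^2 \<le> (1/2)^2" by (intro power_mono) auto
      then have "- (4/3) \<le> 1 / (\<bar>x\<bar>\<^sup>2 - 1)"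
        by (simp add: field_simps power2_eq_square)
      then show ?thesis using True a by (simp add: bump_def)
    qed (use nn in auto)
  qed
  then show "0 < integral UNIV bump" by (smt (verit) exp_gt_zero)
qed

lemma integral_eta: "integral UNIV eta = 1"
  unfolding eta_def using bump_integral(2) by simp

lemma poly_square_integral_eq_0:
  fixes p w :: "real poly"
  assumes ab: "a < b" and w: "\<And>x. a < x \<Longrightarrow> x < b \<Longrightarrow> 0 < poly w x"
    and z: "integral {a..b} (\<lambda>x. poly w x * (poly p x)\<^sup>2) = 0"
  shows "p = 0"
proof (rule ccontr)
  assume p: "p \<noteq> 0"
  let ?f = "\<lambda>x. poly w x * (poly p x)\<^sup>2"
  have cw: "continuous_on {a..b} (poly w)" by (intro continuous_intros)
  have w': "0 \<le> poly w x" if "x \<in> {a..b}" for x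
  proof -
    have "x \<in> closure {a<..<b}" using that ab by simp
    moreover have "closure {a<..<b} \<subseteq> {x. 0 \<le> poly w x}"
      by (intro closure_minimal closed_Collect_le continuous_intros)
         (use w in \<open>force intro: less_imp_le\<close>)
    ultimately show ?thesis by auto
  qed
  have c: "continuous_on {a..b} ?f" by (intro continuous_intros)
  have "(?f has_integral 0) (cbox a b)"
    using z integrable_integral[OF integrable_continuous_real[OF c]] by simp
  then have "?f x = 0" if "x \<in> {a..b}" for x
    by (intro has_integral_0_cbox_imp_0[where f = ?f and a = a and b = b])
       (use c w' that ab in auto)
  then have "poly p x = 0" if "a < x" "x < b" for x
  proof -
    have "poly w x * (poly p x)\<^sup>2 = 0" by (rule \<open>\<And>x. x \<in> {a..b} \<Longrightarrow> poly w x * (poly p x)\<^sup>2 = 0\<close>) (use that in auto)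
    then show ?thesis using w[OF that] by simp
  qed
  then have "{a<..<b} \<subseteq> {x. poly p x = 0}" by auto
  moreover have "finite {x. poly p x = 0}" using p by (rule poly_roots_finite)
  ultimately show False using ab infinite_Ioo finite_subset by blast
qed

lemma legendre_ex1:
  assumes ab: "a < b"
  shows "\<exists>!p. is_legendre a b n p"
proof -
  define ip where "ip p q = integral {a..b} (\<lambda>x. poly p x * poly q x)" for p q
  define P where "P k = {q :: real poly. \<forall>i\<ge>k. coeff q i = 0}" for k
  have int: "(\<lambda>x. poly p x * poly q x) integrable_on {a..b}" for p q
    by (intro integrable_continuous_real continuous_intros)
  have add: "ip (p + q) r = ip p r + ip q r" for p q r
    unfolding ip_def using int[of p r] int[of q r]
    by (simp add: distrib_right Henstock_Kurzweil_Integration.integral_add)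
  have sm: "ip (smult c p) r = c * ip p r" for c p r
    by (simp add: ip_def mult.assoc)
  have sym: "ip p q = ip q p" for p q by (simp add: ip_def mult.commute)
  have diff: "ip (p - q) r = ip p r - ip q r" for p q r
    using add[of "p - q" q r] by simp
  have pos: "p = 0" if "ip p p = 0" for p
    by (rule poly_square_integral_eq_0[OF ab, of 1])
       (use that in \<open>auto simp: ip_def power2_eq_square\<close>)
  have zero: "ip 0 r = 0" for r by (simp add: ip_def)
  have proj: "\<exists>q\<in>P k. \<forall>r\<in>P k. ip (f - q) r = 0" for f k
  proof (induction k arbitrary: f)
    case 0
    have "P 0 = {0}" by (auto simp: P_def poly_eq_iff)
    then show ?case using zero by (auto simp: ip_def)
  next
    case (Suc k)
    obtain q where q: "q \<in> P k" "\<And>r. r \<in> P k \<Longrightarrow> ip (f - q) r = 0" using Suc by blast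
    obtain s where s: "s \<in> P k" "\<And>r. r \<in> P k \<Longrightarrow> ip (monom 1 k - s) r = 0" using Suc by blast
    define e where "e = monom 1 k - s"
    have ek: "coeff e k = 1" "e \<in> P (Suc k)" using s(1) by (auto simp: e_def P_def)
    then have ee: "ip e e \<noteq> 0" using pos by force
    define c where "c = ip f e / ip e e"
    have qe: "ip q e = 0" using s(2)[OF q(1)] by (simp add: e_def sym[of q])
    show ?case
    proof (intro bexI ballI)
      show "q + smult c e \<in> P (Suc k)" using q(1) ek(2) by (auto simp: P_def)
      fix r assume r: "r \<in> P (Suc k)"
      define r0 where "r0 = r - smult (coeff r k) e"
      have r0: "r0 \<in> P k" unfolding P_def r0_def
      proof (safe)
        fix i assume "k \<le> i"
        then show "coeff (r - smult (coeff r k) e) i = 0"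
          using r ek by (cases "i = k") (auto simp: P_def)
      qed
      have 1: "ip g r = ip r0 g + coeff r k * ip e g" for g
        unfolding sym[of g r] r0_def diff sm by simp
      have 2: "ip r0 (f - (q + smult c e)) = 0"
        using q(2)[OF r0] s(2)[OF r0] unfolding sym[of r0 "f - (q + smult c e)"]
        by (simp add: diff add sm e_def)
      have 3: "ip e (f - (q + smult c e)) = 0"
        using qe ee unfolding sym[of e "f - (q + smult c e)"] by (simp add: diff add sm c_def)
      show "ip (f - (q + smult c e)) r = 0" unfolding 1 2 3 by simp
    qed
  qed
  have deg: "q \<in> P n \<longleftrightarrow> q = 0 \<or> degree q < n" for q
  proof
    assume "q \<in> P n"
    then show "q = 0 \<or> degree q < n"
      unfolding P_def by (metis (mono_tags) leading_coeff_0_iff linorder_not_less mem_Collect_eq)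
  qed (auto simp: P_def coeff_eq_0)
  have endpt: "d = 0" if d: "degree d \<le> n" "poly d b = 0" "\<And>r. r \<in> P n \<Longrightarrow> ip d r = 0" for d
  proof -
    obtain q where q: "d = [:-b, 1:] * q" using d(2) by (auto simp: poly_eq_0_iff_dvd)
    have "q \<in> P n"
      using d(1) degree_mult_eq[of "[:-b, 1:]" q] unfolding deg q by (cases "q = 0") (simp_all del: mult_pCons_left)
    then have "ip d q = 0" by (rule d(3))
    moreover have "ip d q = - integral {a..b} (\<lambda>x. poly [:b, -1:] x * (poly q x)\<^sup>2)"
      unfolding ip_def q by (subst Henstock_Kurzweil_Integration.integral_neg[symmetric])
        (auto intro!: Henstock_Kurzweil_Integration.integral_cong simp: power2_eq_square algebra_simps)
    ultimately have "q = 0"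
      by (intro poly_square_integral_eq_0[OF ab, of "[:b, -1:]"]) auto
    then show ?thesis by (simp add: q)
  qed
  have char: "is_legendre a b n p \<longleftrightarrow> degree p = n \<and> (\<forall>q\<in>P n. ip p q = 0) \<and> poly p b = 1" for p
    unfolding is_legendre_def ip_def[symmetric] using zero sym[of p 0] by (metis deg)
  obtain s where s: "s \<in> P n" "\<And>r. r \<in> P n \<Longrightarrow> ip (monom 1 n - s) r = 0" using proj by blast
  define e where "e = monom 1 n - s"
  have en: "coeff e n = 1" using s(1) by (auto simp: e_def P_def)
  have "degree e \<le> n" using s(1) by (intro degree_le) (auto simp: e_def P_def)
  then have de: "degree e = n" using en le_degree[of e n] by simp
  have "e \<noteq> 0" using en by auto
  then have eb: "poly e b \<noteq> 0" using endpt[of e] de s(2)[folded e_def] by auto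
  have "is_legendre a b n (smult (1 / poly e b) e)"
    using de eb s(2)[folded e_def] by (simp add: char sm)
  moreover have "p = p'" if "is_legendre a b n p" "is_legendre a b n p'" for p p'
    using endpt[of "p - p'"] that by (auto simp: char diff degree_diff_le)
  ultimately show ?thesis by blast
qed

end

(* The averaging measure is the same for both families of node functionals, so the weighted
   functionals satisfy N0_bar i u = N1_bar i (d0 u) for i <= m. Since the i-th basis function of
   degree 0 has the i-th one of degree 1 as its derivative for i <= m, and the last one is
   constant, the operators commute with d0. *)
theory Submission
  imports Defs
begin

text \<open>Termwise integration; characteristic 0 permits the division by
  \<open>Suc i\<close>.\<close>

lemma poly_antiderivative_ex:
  fixes p :: "'a::field_char_0 poly"
  obtains q where "pderiv q = p" "degree q \<le> Suc (degree p)" "poly q 0 = 0"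
proof
  let ?q = "\<Sum>i\<le>degree p. monom (coeff p i / of_nat (Suc i)) (Suc i)"
  \<comment> \<open>At order 1, \<open>higher_pderiv_sum\<close> is the linearity of
    \<open>pderiv\<close> over sums. \<open>of_nat (Suc i)\<close> stays folded so that it cancels
    the denominator.\<close>
  have "pderiv ?q = (\<Sum>i\<le>degree p. monom (coeff p i) i)"
    by (simp add: higher_pderiv_sum[of 1, simplified] pderiv_monom del: of_nat_Suc)
  then show "pderiv ?q = p"
    by (simp add: poly_as_sum_of_monoms)
  show "degree ?q \<le> Suc (degree p)"
    by (intro degree_sum_le) (auto intro: order_trans[OF degree_monom_le])
  show "poly ?q 0 = 0"
    by (simp add: poly_sum poly_monom)
qed

lemma integral_pderiv:
  fixes q :: "real poly"
  assumes "a \<le> b"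
  shows "integral {a..b} (poly (pderiv q)) = poly q b - poly q a"
  by (rule integral_unique, rule fundamental_theorem_of_calculus[OF assms])
     (auto simp flip: has_real_derivative_iff_has_vector_derivative intro: poly_DERIV DERIV_subset)

lemma degree_legendre: "a < b \<Longrightarrow> degree (legendre a b n) = n"
  using theI'[OF legendre_ex1, of a b n] by (simp add: legendre_def is_legendre_def)

text \<open>Two antiderivatives of the Legendre polynomial, each vanishing at 0, raise the degree
  from \<open>i\<close> to at most \<open>i + 2\<close>. The restriction to \<open>0 \<le> x\<close>
  is genuine: for negative \<open>x\<close> the set \<open>{0..x}\<close> is empty and the integrals
  are 0.\<close>

lemma K_fun_poly_ex:
  obtains p where "degree p \<le> i + 2"
    "\<And>x. 0 \<le> x \<Longrightarrow> K_fun i x = poly p x" "\<And>x. 0 \<le> x \<Longrightarrow> L_fun i x = poly (pderiv p) x"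
proof -
  obtain q where q: "pderiv q = legendre 0 1 i" "degree q \<le> Suc i" "poly q 0 = 0"
    using poly_antiderivative_ex[of "legendre 0 1 i"] by (metis degree_legendre zero_less_one)
  obtain p where p: "pderiv p = q" "degree p \<le> Suc (degree q)" "poly p 0 = 0"
    using poly_antiderivative_ex .
  have L: "L_fun i x = poly q x" if "0 \<le> x" for x
    using integral_pderiv[OF that, of q] q by (simp add: L_fun_def)
  have "K_fun i x = poly p x" if "0 \<le> x" for x
  proof -
    have "K_fun i x = integral {0..x} (poly q)"
      unfolding K_fun_def by (intro Henstock_Kurzweil_Integration.integral_cong) (simp add: L)
    then show ?thesis
      using integral_pderiv[OF that, of p] p by simp
  qed
  with L p q that[of p] show thesis by simp
qed

text \<open>A single \<open>p\<close> serves both families, so that differentiating a basis function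
  becomes \<open>pderiv\<close>. The three cubics fit the degree bound because
  \<open>3 \<le> m\<close>.\<close>

lemma phi_poly_ex:
  assumes "3 \<le> m" "i \<in> {1..m}"
  shows "\<exists>p. degree p \<le> m \<and> (\<forall>x\<ge>0. phi0 m i x = poly p x \<and> phi1 i x = poly (pderiv p) x)"
proof -
  consider "i = 1" | "i = 2" | "i = 3" | "4 \<le> i" using assms by force
  then show ?thesis
  proof cases
    case 1
    with assms show ?thesis
      by (intro exI[of _ "[:0, 1, -2, 1:]"])
         (auto simp: phi0_def phi1_def pderiv_pCons power2_eq_square power3_eq_cube algebra_simps)
  next
    case 2
    with assms show ?thesis
      by (intro exI[of _ "[:0, 0, -1, 1:]"])
         (auto simp: phi0_def phi1_def pderiv_pCons power2_eq_square power3_eq_cube algebra_simps)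
  next
    case 3
    with assms show ?thesis
      by (intro exI[of _ "[:-1/2, 0, 3, -2:]"])
         (auto simp: phi0_def phi1_def pderiv_pCons power2_eq_square power3_eq_cube algebra_simps)
  next
    case 4
    \<comment> \<open>Since \<open>4 \<le> i\<close>, the truncated \<open>i - 2 + 2\<close> equals
      \<open>i\<close>, which is at most \<open>m\<close>.\<close>
    obtain p where "degree p \<le> i - 2 + 2" "\<And>x. 0 \<le> x \<Longrightarrow> K_fun (i - 2) x = poly p x"
      "\<And>x. 0 \<le> x \<Longrightarrow> L_fun (i - 2) x = poly (pderiv p) x"
      by (rule K_fun_poly_ex[of "i - 2"]) blast
    with 4 assms show ?thesis
      by (intro exI[of _ p]) (auto simp: phi0_def phi1_def)
  qed
qed

text \<open>The integrands already agree at all nodes: only the functional with index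
  \<open>m + 1\<close>, excluded here, evaluates \<open>u\<close> itself instead of its
  derivative.\<close>

lemma N0_bar_eq_N1_bar:
  assumes "i \<le> m"
  shows "N0_bar m \<rho> i u = N1_bar \<rho> i (d0 (I_ext \<rho>) u)"
proof -
  have "N0 m \<rho> a b i u = N1 a b i (d0 (I_ext \<rho>) u)" for a b
    using assms by (auto simp: N0_def N1_def)
  then show ?thesis by (simp add: N0_bar_def N1_bar_def)
qed

text \<open>Agreement on \<open>I_unit\<close> is enough, even at the end points, because the
  derivative is taken within this interval, where it is unique.\<close>

lemma d0_I_unit_poly:
  assumes "\<And>y. y \<in> I_unit \<Longrightarrow> f y = poly p y" and "x \<in> I_unit"
  shows "d0 I_unit f x = poly (pderiv p) x"
proof -
  have "(poly p has_real_derivative poly (pderiv p) x) (at x within I_unit)"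
    by (intro DERIV_subset[OF poly_DERIV]) simp
  then have "(f has_real_derivative poly (pderiv p) x) (at x within I_unit)"
    using assms by (auto intro: has_field_derivative_transform_within[OF _ zero_less_one])
  then show ?thesis
    using assms(2) unfolding d0_def I_unit_def has_real_derivative_iff_has_vector_derivative
    by (intro vector_derivative_within_closed_interval) auto
qed

theorem mainTheorem9:
  fixes m :: nat and \<rho> :: real
  assumes "3 \<le> m" and "0 < \<rho>" and "\<rho> \<le> 1/3"
  shows "Pi0 m \<rho> \<in> C1_forms0 (I_ext \<rho>) \<rightarrow> poly_forms m I_unit \<and>
         Pi1 m \<rho> \<in> C0_forms1 (I_ext \<rho>) \<rightarrow> poly_forms (m - 1) I_unit \<and>
         (\<forall>u \<in> C1_forms0 (I_ext \<rho>). \<forall>x \<in> I_unit.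
            d0 I_unit (Pi0 m \<rho> u) x = Pi1 m \<rho> (d0 (I_ext \<rho>) u) x)"
proof -
  \<comment> \<open>Choice turns the polynomials of \<open>phi_poly_ex\<close> into a family indexed
    by \<open>i\<close>.\<close>
  obtain p where deg: "\<And>i. i \<in> {1..m} \<Longrightarrow> degree (p i) \<le> m"
    and phi0: "\<And>i x. i \<in> {1..m} \<Longrightarrow> x \<in> I_unit \<Longrightarrow> phi0 m i x = poly (p i) x"
    and phi1: "\<And>i x. i \<in> {1..m} \<Longrightarrow> x \<in> I_unit \<Longrightarrow> phi1 i x = poly (pderiv (p i)) x"
    using phi_poly_ex[OF assms(1)] unfolding I_unit_def by (metis atLeastAtMost_iff)
  define P where "P u = (\<Sum>i = 1..m. smult (N0_bar m \<rho> i u) (p i)) + [:N0_bar m \<rho> (m + 1) u / 2:]" for u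
  define Q where "Q v = (\<Sum>i = 1..m. smult (N1_bar \<rho> i v) (pderiv (p i)))" for v
  have Pi0: "Pi0 m \<rho> u x = poly (P u) x" if "x \<in> I_unit" for u x
  proof -
    \<comment> \<open>\<open>3 \<le> m\<close> keeps the index \<open>m + 1\<close> apart from 1, 2
      and 3.\<close>
    have "phi0 m (m + 1) x = 1 / 2" using assms(1) by (simp add: phi0_def)
    then show ?thesis using phi0 that by (simp add: Pi0_def P_def poly_sum)
  qed
  have Pi1: "Pi1 m \<rho> v x = poly (Q v) x" if "x \<in> I_unit" for v x
    using phi1 that by (simp add: Pi1_def Q_def poly_sum)
  \<comment> \<open>The constant summand of \<open>P u\<close> vanishes; the others match those of
    \<open>Q\<close> coefficient by coefficient.\<close>
  have "pderiv (P u) = Q (d0 (I_ext \<rho>) u)" for u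
    by (simp add: P_def Q_def pderiv_add higher_pderiv_sum[of 1, simplified] pderiv_smult pderiv_pCons N0_bar_eq_N1_bar)
  then have "d0 I_unit (Pi0 m \<rho> u) x = Pi1 m \<rho> (d0 (I_ext \<rho>) u) x" if "x \<in> I_unit" for u x
    using d0_I_unit_poly[OF Pi0 that] that by (simp add: Pi1)
  moreover have "degree (P u) \<le> m" for u
    unfolding P_def using deg
    by (intro degree_add_le degree_sum_le) (auto intro: order_trans[OF degree_smult_le])
  moreover have "degree (Q v) \<le> m - 1" for v
    unfolding Q_def using deg
    by (intro degree_sum_le) (auto simp: degree_pderiv intro!: order_trans[OF degree_smult_le] diff_le_mono)
  ultimately show ?thesis
    using Pi0 Pi1 unfolding poly_forms_def by blast
qed

end
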